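(* For every positive integer $t$, if $n$ is sufficiently large in terms of $t$, then $\mathrm{ex}(n,F_{t,t})\le 5t^{3/2}n^{3/2}$.
   Context: $\mathrm{ex}(n,F)$ is the maximum number of edges in an $n$-vertex graph with no subgraph isomorphic to $F$. The grid $F_{t,t}$ is the graph with vertex set $[t]\times[t]$ in which two vertices are adjacent if and only if they differ in exactly one coordinate and in that coordinate they differ by exactly one. *)

theory Defs
  imports Complex_Main
begin

definition all_edges :: "'a set \<Rightarrow> 'a set set" where
  "all_edges V = {e. \<exists>u v. e = {u, v} \<and> u \<noteq> v \<and> u \<in> V \<and> v \<in> V}"

definition simple_graph :: "'a set \<Rightarrow> 'a set set \<Rightarrow> bool" where
  "simple_graph V E \<longleftrightarrow> E \<subseteq> all_edges V"

definition contains_copy :: "'a set \<Rightarrow> 'a set set \<Rightarrow> 'b set \<Rightarrow> 'b set set \<Rightarrow> bool" where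
  "contains_copy V E VF EF \<longleftrightarrow>
     (\<exists>f. inj_on f VF \<and> f ` VF \<subseteq> V \<and> (\<forall>e\<in>EF. f ` e \<in> E))"

text \<open>Turan number ex(n, F): maximum number of edges of an F-free graph on the
  n-vertex set {0..<n} (the supremum over nat; it is 0 if no such graph exists).\<close>

definition ex :: "nat \<Rightarrow> 'b set \<Rightarrow> 'b set set \<Rightarrow> nat" where
  "ex n VF EF = Sup {card E | E. simple_graph {0..<n} E \<and> \<not> contains_copy {0..<n} E VF EF}"

definition grid_vertices :: "nat \<Rightarrow> (nat \<times> nat) set" where
  "grid_vertices t = {1..t} \<times> {1..t}"

definition grid_edges :: "nat \<Rightarrow> (nat \<times> nat) set set" where
  "grid_edges t = {{x, y} | x y. x \<in> grid_vertices t \<and> y \<in> grid_vertices t \<and>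
      ((fst x = fst y \<and> snd y = snd x + 1) \<or> (snd x = snd y \<and> fst y = fst x + 1))}"

end

theory Submission
  imports Defs
begin

text \<open>Pass to a subgraph of minimum degree at least \<open>c = 5 t\<^sup>3\<^sup>/\<^sup>2 n\<^sup>1\<^sup>/\<^sup>2\<close> and consider its walks with
  \<open>2 t\<close> vertices, weighted by the product of the inverse degrees of the inner vertices. As long as some
  walk has fewer than \<open>t\<^sup>2\<close> surviving variants differing from it only in its \<open>i\<close>-th vertex, delete
  that whole class of variants. The deleted weight is at most \<open>t\<^sup>2 (2 n + (2 t - 2) n\<^sup>2 / c)\<close>, which is
  less than the total weight, at least \<open>c n\<close>. In the surviving family every single vertex of a walk can
  be exchanged while avoiding any fewer than \<open>t\<^sup>2\<close> given vertices. A walk swept over the grid,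
  with the diagonals of the grid as its positions, then builds the grid one vertex at a time.\<close>

section \<open>Deleting small classes in a weighted set\<close>

text \<open>Induction on \<open>card S\<close>: if some class has fewer than \<open>s\<close>
  members, delete all of it. Each pair of an index and a value is charged at most once, so the
  strict inequality survives each deletion. The charges are nonnegative, hence the remaining weight
  stays positive and the final set is nonempty.\<close>

lemma robust_subset:
  fixes w :: "'a \<Rightarrow> real" and \<pi> :: "'i \<Rightarrow> 'a \<Rightarrow> 'b" and B :: "'i \<Rightarrow> 'b \<Rightarrow> real" and s :: nat
  assumes "finite S" "finite I"
    and wB: "\<And>i x. i \<in> I \<Longrightarrow> x \<in> S \<Longrightarrow> w x \<le> B i (\<pi> i x)"
    and w0: "\<And>x. x \<in> S \<Longrightarrow> 0 \<le> w x"
    and less: "(\<Sum>i\<in>I. \<Sum>b\<in>\<pi> i ` S. s * B i b) < sum w S"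
  shows "\<exists>T\<subseteq>S. T \<noteq> {} \<and> (\<forall>x\<in>T. \<forall>i\<in>I. s \<le> card {y \<in> T. \<pi> i y = \<pi> i x})"
  using assms
proof (induction "card S" arbitrary: S rule: less_induct)
  case less
  note fin = less.prems(1,2) and wB = less.prems(3) and w0 = less.prems(4) and lt = less.prems(5)
  have B0: "0 \<le> B i b" if "i \<in> I" "b \<in> \<pi> i ` S" for i b
    using that wB w0 by (metis imageE order_trans)
  show ?case
  proof (cases "\<forall>x\<in>S. \<forall>i\<in>I. s \<le> card {y \<in> S. \<pi> i y = \<pi> i x}")
    case True
    have "0 \<le> (\<Sum>i\<in>I. \<Sum>b\<in>\<pi> i ` S. s * B i b)"
      using B0 by (intro sum_nonneg) auto
    with lt have "S \<noteq> {}" by auto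
    with True show ?thesis by blast
  next
    case False
    then obtain x i where xi: "x \<in> S" "i \<in> I" "card {y \<in> S. \<pi> i y = \<pi> i x} < s"
      by (auto simp: not_le)
    define C where "C = {y \<in> S. \<pi> i y = \<pi> i x}"
    define S' where "S' = S - C"
    have CS: "C \<subseteq> S" "x \<in> C" using xi by (auto simp: C_def)
    have finC: "finite C" using CS fin finite_subset by blast
    have finS': "finite S'" using fin by (simp add: S'_def)
    have smaller: "card S' < card S"
      unfolding S'_def using CS fin by (intro psubset_card_mono) auto
    have "sum w C \<le> (\<Sum>y\<in>C. B i (\<pi> i x))"
    proof (rule sum_mono)
      fix y assume "y \<in> C"
      then show "w y \<le> B i (\<pi> i x)" using wB[of i y] xi by (simp add: C_def)
    qed
    also have "\<dots> \<le> s * B i (\<pi> i x)"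
      using xi B0[of i "\<pi> i x"] by (auto simp: C_def intro!: mult_right_mono)
    finally have wC: "sum w C \<le> s * B i (\<pi> i x)" .
    have wS: "sum w S = sum w S' + sum w C"
      using CS fin unfolding S'_def by (intro sum.subset_diff) auto
    \<comment> \<open>Since the whole class goes, its value leaves the image and the left side drops
      by \<open>s * B i (\<pi> i x)\<close>, which is at least the weight lost on the right.\<close>
    have img: "\<pi> i ` S' = \<pi> i ` S - {\<pi> i x}"
      by (auto simp: S'_def C_def)
    have img_sum: "(\<Sum>b\<in>\<pi> i ` S. s * B i b) = s * B i (\<pi> i x) + (\<Sum>b\<in>\<pi> i ` S'. s * B i b)"
      unfolding img using fin xi by (intro sum.remove) auto
    have others: "(\<Sum>j\<in>I - {i}. \<Sum>b\<in>\<pi> j ` S'. s * B j b) \<le> (\<Sum>j\<in>I - {i}. \<Sum>b\<in>\<pi> j ` S. s * B j b)"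
      using fin B0 by (intro sum_mono sum_mono2) (auto simp: S'_def)
    have split: "(\<Sum>j\<in>I. \<Sum>b\<in>\<pi> j ` Z. s * B j b)
        = (\<Sum>b\<in>\<pi> i ` Z. s * B i b) + (\<Sum>j\<in>I - {i}. \<Sum>b\<in>\<pi> j ` Z. s * B j b)" for Z
      using fin(2) xi(2) by (rule sum.remove)
    from img_sum others split[of S] split[of S'] have "(\<Sum>j\<in>I. \<Sum>b\<in>\<pi> j ` S'. s * B j b) + s * B i (\<pi> i x)
        \<le> (\<Sum>j\<in>I. \<Sum>b\<in>\<pi> j ` S. s * B j b)"
      by linarith
    then have "(\<Sum>j\<in>I. \<Sum>b\<in>\<pi> j ` S'. s * B j b) < sum w S'"
      using lt wC wS by linarith
    then have "\<exists>T\<subseteq>S'. T \<noteq> {} \<and> (\<forall>x\<in>T. \<forall>i\<in>I. s \<le> card {y \<in> T. \<pi> i y = \<pi> i x})"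
      using less.hyps[OF smaller finS' fin(2)] wB w0 by (simp add: S'_def)
    then show ?thesis by (auto simp: S'_def)
  qed
qed

section \<open>Subgraphs of large minimum degree\<close>

text \<open>The vertex set is a parameter so that an induced subgraph can be treated without
  restricting \<open>E\<close>.\<close>

definition nbhd :: "'a set set \<Rightarrow> 'a set \<Rightarrow> 'a \<Rightarrow> 'a set" where
  "nbhd E U v = {u \<in> U. {v, u} \<in> E}"

text \<open>Removing a vertex of degree below \<open>c\<close> loses fewer than \<open>c\<close>
  edges while \<open>c * card V\<close> falls by exactly \<open>c\<close>, so the density hypothesis
  persists. It forces an edge, so the process stops before the vertices run out.\<close>

lemma min_degree_subgraph:
  fixes c :: real
  assumes "finite V" "simple_graph V E" "0 \<le> c" "c * card V < card E"
  shows "\<exists>U\<subseteq>V. U \<noteq> {} \<and> (\<forall>v\<in>U. c \<le> card (nbhd E U v))"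
  using assms
proof (induction "card V" arbitrary: V E rule: less_induct)
  case less
  show ?case
  proof (cases "\<forall>v\<in>V. c \<le> card (nbhd E V v)")
    case True
    have "0 < card E" using less.prems by (metis mult_nonneg_nonneg of_nat_0_le_iff of_nat_0_less_iff order_le_less_trans)
    then have "E \<noteq> {}" by auto
    then have "V \<noteq> {}" using less.prems(2) by (auto simp: simple_graph_def all_edges_def)
    with True show ?thesis by blast
  next
    case False
    then obtain v where v: "v \<in> V" "card (nbhd E V v) < c" by (auto simp: not_le)
    define E' where "E' = {e \<in> E. v \<notin> e}"
    have E: "E \<subseteq> all_edges V" using less.prems(2) by (simp add: simple_graph_def)
    then have "E \<subseteq> Pow V" by (auto simp: all_edges_def)
    then have finE: "finite E" using less.prems(1) by (meson finite_Pow_iff finite_subset)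
    have E': "simple_graph (V - {v}) E'"
      using E by (fastforce simp: simple_graph_def all_edges_def E'_def)
    have "E \<subseteq> E' \<union> (\<lambda>u. {v, u}) ` nbhd E V v"
    proof
      fix e assume e: "e \<in> E"
      then obtain a b where ab: "e = {a, b}" "a \<in> V" "b \<in> V" using E by (auto simp: all_edges_def)
      show "e \<in> E' \<union> (\<lambda>u. {v, u}) ` nbhd E V v"
      proof (cases "v \<in> e")
        case True
        then obtain u where "e = {v, u}" "u \<in> V" using ab by (auto simp: insert_commute)
        then show ?thesis using e by (auto simp: nbhd_def)
      qed (use e in \<open>simp add: E'_def\<close>)
    qed
    moreover have finN: "finite (nbhd E V v)" using less.prems(1) by (simp add: nbhd_def)
    moreover have "finite E'" using finE by (simp add: E'_def)
    ultimately have "card E \<le> card E' + card (nbhd E V v)"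
      by (meson card_Un_le card_image_le card_mono finite_UnI finite_imageI add_left_mono order_trans)
    then have "real (card E) < card E' + c" using v by linarith
    moreover have "card V = Suc (card (V - {v}))"
      using less.prems(1) v(1) by (rule card.remove)
    then have "c * card V = c * card (V - {v}) + c"
      by (simp only: of_nat_Suc distrib_left mult_1_right add.commute)
    ultimately have "c * card (V - {v}) < card E'"
      using less.prems(4) by linarith
    moreover have "card (V - {v}) < card V"
      using less.prems(1) v(1) by (rule card_Diff1_less)
    ultimately obtain U where U: "U \<subseteq> V - {v}" "U \<noteq> {}" "\<forall>u\<in>U. c \<le> card (nbhd E' U u)"
      using less.hyps[OF _ _ E'] less.prems by blast
    have "card (nbhd E' U u) \<le> card (nbhd E U u)" for u
      using U(1) less.prems(1) by (intro card_mono) (auto simp: nbhd_def E'_def intro: finite_subset)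
    then have "\<forall>u\<in>U. c \<le> card (nbhd E U u)"
      using U(3) by (meson of_nat_mono order_trans)
    then show ?thesis using U by blast
  qed
qed

section \<open>Walks and their weights\<close>

text \<open>The parameter \<open>k\<close> counts vertices, not edges, and vertices may
  repeat.\<close>

definition walks :: "'a set set \<Rightarrow> 'a set \<Rightarrow> nat \<Rightarrow> 'a list set" where
  "walks E U k = {p. length p = k \<and> set p \<subseteq> U \<and> successively (\<lambda>u v. {u, v} \<in> E) p}"

lemma finite_walks: "finite U \<Longrightarrow> finite (walks E U k)"
  unfolding walks_def by (rule finite_subset[OF _ finite_lists_length_eq[of U k]]) auto

lemma walks_rev: "rev ` walks E U k = walks E U k"
proof -
  have "rev p \<in> walks E U k" if "p \<in> walks E U k" for p
    using that by (auto simp: walks_def insert_commute)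
  then show ?thesis by (metis image_subset_iff rev_rev_ident subsetI subset_antisym image_eqI)
qed

lemma walks_append:
  "p @ q \<in> walks E U k \<Longrightarrow> p \<in> walks E U (length p) \<and> q \<in> walks E U (length q)"
  by (auto simp: walks_def successively_append_iff)

lemma walks_snoc:
  "walks E U (Suc (Suc k)) = (\<lambda>(p, x). p @ [x]) ` (SIGMA p:walks E U (Suc k). nbhd E U (last p))"
  (is "?L = ?R")
proof
  show "?L \<subseteq> ?R"
  proof
    fix q assume q: "q \<in> ?L"
    then have "length q = Suc (Suc k)" by (simp add: walks_def)
    then obtain p x where px: "q = p @ [x]" "length p = Suc k" by (auto simp: length_Suc_conv_rev)
    then have "p \<in> walks E U (Suc k)" "x \<in> nbhd E U (last p)"
      using q by (auto simp: walks_def nbhd_def successively_append_iff)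
    then show "q \<in> ?R" using px by force
  qed
  show "?R \<subseteq> ?L" by (auto simp: walks_def nbhd_def successively_append_iff)
qed

lemma walks_Cons:
  "walks E U (Suc (Suc k)) = (\<lambda>(p, x). x # p) ` (SIGMA p:walks E U (Suc k). nbhd E U (hd p))"
  (is "?L = ?R")
proof
  show "?L \<subseteq> ?R"
  proof
    fix q assume q: "q \<in> ?L"
    then obtain x p where px: "q = x # p" "length p = Suc k" by (auto simp: walks_def length_Suc_conv)
    then have "p \<in> walks E U (Suc k)" "x \<in> nbhd E U (hd p)"
      using q by (auto simp: walks_def nbhd_def successively_Cons insert_commute)
    then show "q \<in> ?R" using px by force
  qed
  show "?R \<subseteq> ?L" by (auto simp: walks_def nbhd_def successively_Cons insert_commute)
qed

text \<open>With positive degrees, \<open>inv_degs E U (butlast p)\<close> is the probability that a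
  simple random walk on \<open>U\<close> started at \<open>hd p\<close> follows the walk
  \<open>p\<close>.\<close>

definition inv_degs :: "'a set set \<Rightarrow> 'a set \<Rightarrow> 'a list \<Rightarrow> real" where
  "inv_degs E U p = (\<Prod>v\<leftarrow>p. 1 / card (nbhd E U v))"

lemma inv_degs_simps [simp]:
  "inv_degs E U [] = 1"
  "inv_degs E U (v # p) = inv_degs E U p / card (nbhd E U v)"
  "inv_degs E U (p @ q) = inv_degs E U p * inv_degs E U q"
  by (auto simp: inv_degs_def)

lemma inv_degs_nonneg: "0 \<le> inv_degs E U p"
  by (induction p) auto

lemma inv_degs_rev: "inv_degs E U (rev p) = inv_degs E U p"
  by (induction p) auto

text \<open>The two sides of the gap are kept apart because each is itself a walk and the weight
  factors over them.\<close>

definition omit :: "nat \<Rightarrow> 'a list \<Rightarrow> 'a list \<times> 'a list" where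
  "omit i p = (take i p, drop (Suc i) p)"

locale min_degree =
  fixes E :: "'a set set" and U :: "'a set" and c :: real
  assumes finite_U: "finite U" and c_pos: "0 < c"
    and deg: "v \<in> U \<Longrightarrow> c \<le> card (nbhd E U v)"
begin

text \<open>The random walk has total probability 1 from each start: extending a walk splits its
  weight equally among the neighbours of its last vertex.\<close>

lemma sum_walks_butlast: "(\<Sum>p\<in>walks E U (Suc k). inv_degs E U (butlast p)) = card U"
proof (induction k)
  case 0
  have "walks E U (Suc 0) = (\<lambda>v. [v]) ` U" by (auto simp: walks_def length_Suc_conv)
  then show ?case by (simp add: sum.reindex inj_on_def)
next
  case (Suc k)
  have "(\<Sum>p\<in>walks E U (Suc (Suc k)). inv_degs E U (butlast p))
      = (\<Sum>(p, x)\<in>(SIGMA p:walks E U (Suc k). nbhd E U (last p)). inv_degs E U p)"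
    unfolding walks_snoc by (subst sum.reindex) (auto simp: inj_on_def intro!: sum.cong)
  also have "\<dots> = (\<Sum>p\<in>walks E U (Suc k). card (nbhd E U (last p)) * inv_degs E U p)"
    using finite_U by (subst sum.Sigma[symmetric]) (auto simp: finite_walks nbhd_def)
  also have "\<dots> = (\<Sum>p\<in>walks E U (Suc k). inv_degs E U (butlast p))"
  proof (rule sum.cong)
    fix p assume p: "p \<in> walks E U (Suc k)"
    then have ne: "p \<noteq> []" and "last p \<in> U"
      using last_in_set[of p] by (fastforce simp: walks_def)+
    then have "0 < real (card (nbhd E U (last p)))" using deg c_pos by fastforce
    moreover have "inv_degs E U p = inv_degs E U (butlast p) / card (nbhd E U (last p))"
      using inv_degs_simps(3)[of E U "butlast p" "[last p]"] ne by simp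
    ultimately show "card (nbhd E U (last p)) * inv_degs E U p = inv_degs E U (butlast p)" by simp
  qed simp
  finally show ?case using Suc by simp
qed

lemma sum_walks_tl: "(\<Sum>p\<in>walks E U (Suc k). inv_degs E U (tl p)) = card U"
proof -
  have "(\<Sum>p\<in>walks E U (Suc k). inv_degs E U (butlast p))
      = (\<Sum>p\<in>rev ` walks E U (Suc k). inv_degs E U (butlast p))"
    by (simp add: walks_rev)
  also have "\<dots> = (\<Sum>p\<in>walks E U (Suc k). inv_degs E U (tl p))"
    by (subst sum.reindex) (auto simp: butlast_rev inv_degs_rev)
  finally show ?thesis using sum_walks_butlast by simp
qed

text \<open>A new first vertex carries no weight of its own and can be chosen in at least
  \<open>c\<close> ways, so prepending it multiplies the previous total by at least
  \<open>c\<close>.\<close>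

lemma sum_walks_inner: "c * card U \<le> (\<Sum>p\<in>walks E U (Suc (Suc k)). inv_degs E U (butlast (tl p)))"
proof -
  have "c * card U = (\<Sum>p\<in>walks E U (Suc k). c * inv_degs E U (butlast p))"
    by (simp add: sum_walks_butlast flip: sum_distrib_left)
  also have "\<dots> \<le> (\<Sum>p\<in>walks E U (Suc k). card (nbhd E U (hd p)) * inv_degs E U (butlast p))"
  proof (rule sum_mono)
    fix p assume "p \<in> walks E U (Suc k)"
    then have "hd p \<in> U" using hd_in_set[of p] by (fastforce simp: walks_def)
    then show "c * inv_degs E U (butlast p) \<le> card (nbhd E U (hd p)) * inv_degs E U (butlast p)"
      by (intro mult_right_mono deg inv_degs_nonneg)
  qed
  also have "\<dots> = (\<Sum>(p, x)\<in>(SIGMA p:walks E U (Suc k). nbhd E U (hd p)). inv_degs E U (butlast p))"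
    using finite_U by (subst sum.Sigma[symmetric]) (auto simp: finite_walks nbhd_def)
  also have "\<dots> = (\<Sum>p\<in>walks E U (Suc (Suc k)). inv_degs E U (butlast (tl p)))"
    unfolding walks_Cons by (subst sum.reindex) (auto simp: inj_on_def intro!: sum.cong)
  finally show ?thesis .
qed

text \<open>This is \<open>robust_subset\<close> with the maps \<open>omit i\<close>. With
  \<open>n = card U\<close>, the charges total at most \<open>s * (2 * n + k * n^2 / c)\<close>,
  against a weight of at least \<open>c * n\<close>; \<open>bound\<close> is this comparison
  multiplied by \<open>c / n\<close>.\<close>

lemma robust_walks:
  fixes s k :: nat
  assumes "U \<noteq> {}" and bound: "s * (2 * c + k * real (card U)) < c\<^sup>2"
  shows "\<exists>T\<subseteq>walks E U (Suc (Suc k)). T \<noteq> {} \<and>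
    (\<forall>p\<in>T. \<forall>i<Suc (Suc k). s \<le> card {q \<in> T. omit i q = omit i p})"
proof -
  let ?W = "walks E U (Suc (Suc k))" and ?n = "real (card U)"
  define w where "w p = inv_degs E U (butlast (tl p))" for p
  \<comment> \<open>An end vertex does not enter the weight, so there the bound is exact; an inner
    vertex contributes a factor of at most \<open>1 / c\<close>.\<close>
  define B where "B i = (\<lambda>(l, r). if i = 0 then inv_degs E U (butlast r)
    else if i = Suc k then inv_degs E U (tl l)
    else inv_degs E U (tl l) * inv_degs E U (butlast r) / c)" for i :: nat
  define M where "M i = (if i = 0 \<or> i = Suc k then ?n else ?n * ?n / c)" for i
  have B0: "0 \<le> B i x" for i x
    using c_pos by (auto simp: B_def inv_degs_nonneg split: prod.split)
  have wB: "w p \<le> B i (omit i p)" if i: "i < Suc (Suc k)" and p: "p \<in> ?W" for i p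
  proof -
    define l x r where lxr: "l = take i p" "x = p ! i" "r = drop (Suc i) p"
    have len: "length p = Suc (Suc k)" using p by (simp add: walks_def)
    then have eq: "p = l @ x # r" and ll: "length l = i" "length r = Suc k - i" and "x \<in> set p"
      using i by (auto simp: lxr id_take_nth_drop)
    then have "c \<le> card (nbhd E U x)" using p by (intro deg) (auto simp: walks_def)
    moreover have "0 \<le> inv_degs E U (tl l) * inv_degs E U (butlast r)"
      by (simp add: inv_degs_nonneg)
    ultimately have "inv_degs E U (tl l) * inv_degs E U (butlast r) / card (nbhd E U x)
        \<le> inv_degs E U (tl l) * inv_degs E U (butlast r) / c"
      using c_pos by (intro divide_left_mono) auto
    moreover have "omit i p = (l, r)" by (simp add: omit_def lxr)
    \<comment> \<open>Stripping the ends of the walk removes the omitted vertex exactly when one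
      side of the gap is empty.\<close>
    moreover have "l = [] \<longleftrightarrow> i = 0" "r = [] \<longleftrightarrow> i = Suc k"
      using ll i by auto
    ultimately show ?thesis
      unfolding w_def eq B_def by (cases l) (auto simp: butlast_append)
  qed
  have sumB: "(\<Sum>x\<in>omit i ` ?W. B i x) \<le> M i" if i: "i < Suc (Suc k)" for i
  proof -
    have sub: "omit i ` ?W \<subseteq> walks E U i \<times> walks E U (Suc k - i)"
    proof clarify
      fix p l r assume p: "p \<in> ?W" and lr: "(l, r) = omit i p"
      then have len: "length p = Suc (Suc k)" by (simp add: walks_def)
      have "take i p @ drop i p \<in> ?W" "take (Suc i) p @ drop (Suc i) p \<in> ?W" using p by simp_all
      from this[THEN walks_append] show "l \<in> walks E U i \<and> r \<in> walks E U (Suc k - i)"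
        using len i lr by (simp add: omit_def)
    qed
    \<comment> \<open>Allowing all pairs of walks, even those that no vertex joins, turns the sum
      into a product of two known totals.\<close>
    have "(\<Sum>x\<in>omit i ` ?W. B i x) \<le> (\<Sum>x\<in>walks E U i \<times> walks E U (Suc k - i). B i x)"
      using sub finite_U B0 by (intro sum_mono2) (auto simp: finite_walks)
    also have "\<dots> = M i"
    proof -
      consider "i = 0" | "i = Suc k" | j m where "i = Suc j" "Suc k - i = Suc m"
        using i by (metis Suc_diff_Suc Suc_lessI less_Suc_eq not0_implies_Suc)
      then show ?thesis
      proof cases
        case 1
        have "walks E U 0 = {[]}" by (auto simp: walks_def)
        then show ?thesis using 1
          by (simp add: B_def M_def sum_walks_butlast flip: sum.cartesian_product)
      next
        case 2
        have "walks E U 0 = {[]}" by (auto simp: walks_def)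
        then show ?thesis using 2
          by (simp add: B_def M_def sum_walks_tl flip: sum.cartesian_product)
      next
        case 3
        have "(\<Sum>x\<in>walks E U i \<times> walks E U (Suc k - i). B i x)
          = (\<Sum>l\<in>walks E U (Suc j). \<Sum>r\<in>walks E U (Suc m). inv_degs E U (tl l) * inv_degs E U (butlast r) / c)"
          using 3 by (auto simp: B_def sum.cartesian_product intro!: sum.cong)
        also have "\<dots> = (\<Sum>l\<in>walks E U (Suc j). inv_degs E U (tl l))
            * (\<Sum>r\<in>walks E U (Suc m). inv_degs E U (butlast r)) / c"
          by (simp add: sum_product sum_divide_distrib)
        finally show ?thesis using 3 by (simp add: M_def sum_walks_butlast sum_walks_tl)
      qed
    qed
    finally show ?thesis .
  qed
  have "(\<Sum>i<Suc (Suc k). M i) = M 0 + (\<Sum>i<k. M (Suc i)) + M (Suc k)"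
    by (simp only: sum.lessThan_Suc[of M "Suc k"] sum.lessThan_Suc_shift[of M k])
  also have "\<dots> = 2 * ?n + k * (?n * ?n / c)"
    by (simp add: M_def)
  finally have sumM: "(\<Sum>i<Suc (Suc k). M i) = 2 * ?n + k * (?n * ?n / c)" .
  have "(\<Sum>i<Suc (Suc k). \<Sum>x\<in>omit i ` ?W. s * B i x) \<le> (\<Sum>i<Suc (Suc k). s * M i)"
    using sumB by (intro sum_mono) (auto simp flip: sum_distrib_left intro!: mult_left_mono)
  also have "\<dots> = s * (2 * ?n + k * (?n * ?n / c))"
    using sumM by (simp only: flip: sum_distrib_left)
  also have "\<dots> = s * (2 * c + k * ?n) * ?n / c"
    using c_pos by (simp add: field_simps)
  also have "\<dots> < c\<^sup>2 * ?n / c"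
    using c_pos assms finite_U by (intro divide_strict_right_mono mult_strict_right_mono) (auto simp: card_gt_0_iff)
  also have "\<dots> = c * ?n" using c_pos by (simp add: power2_eq_square)
  also have "\<dots> \<le> sum w ?W" unfolding w_def by (rule sum_walks_inner)
  finally have "(\<Sum>i<Suc (Suc k). \<Sum>x\<in>omit i ` ?W. s * B i x) < sum w ?W" .
  then have "\<exists>T\<subseteq>?W. T \<noteq> {} \<and> (\<forall>p\<in>T. \<forall>i\<in>{..<Suc (Suc k)}. s \<le> card {q \<in> T. omit i q = omit i p})"
    using wB finite_U by (intro robust_subset[where w = w and B = B]) (auto simp: finite_walks w_def inv_degs_nonneg)
  then show ?thesis by auto
qed

end

section \<open>Sweeping a walk over the grid\<close>

text \<open>Members of one class are determined by their \<open>i\<close>-th vertex, so more than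
  \<open>card X\<close> different vertices occur there and one of them lies outside
  \<open>X\<close>.\<close>

lemma exchange_vertex:
  assumes "i < length p" "finite X" "card X < card {q \<in> T. omit i q = omit i p}"
    and len: "\<And>q. q \<in> T \<Longrightarrow> length q = length p"
  shows "\<exists>v. v \<notin> X \<and> p[i := v] \<in> T"
proof -
  let ?C = "{q \<in> T. omit i q = omit i p}"
  have eq: "q = p[i := q ! i]" if "q \<in> ?C" for q
    using that assms(1) len id_take_nth_drop[of i q] by (auto simp: omit_def upd_conv_take_nth_drop)
  then have "inj_on (\<lambda>q. q ! i) ?C" by (metis (no_types, lifting) inj_onI)
  then have "card ((\<lambda>q. q ! i) ` ?C) = card ?C" by (rule card_image)
  then have "\<not> (\<lambda>q. q ! i) ` ?C \<subseteq> X"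
    using assms(2,3) card_mono[of X "(\<lambda>q. q ! i) ` ?C"] by linarith
  then obtain q where "q \<in> ?C" "q ! i \<notin> X" by blast
  then show ?thesis using eq by (metis (no_types, lifting) mem_Collect_eq)
qed

text \<open>The grid cells are numbered \<open>m = a t + b\<close> row by row (from 0), and \<open>diagonal\<close> is the walk position
  that hosts the cell. The last \<open>t + 1\<close> cells placed still sit on the current walk.\<close>

definition diagonal :: "nat \<Rightarrow> nat \<Rightarrow> nat" where
  "diagonal t m = m div t + t - m mod t"

lemma diagonal_eq: "b < t \<Longrightarrow> diagonal t (a * t + b) = a + t - b"
  by (simp add: diagonal_def)

lemma diagonal_bounds:
  assumes "m < t * t"
  shows "0 < diagonal t m" "diagonal t m < 2 * t"
proof -
  have "0 < t" using assms by (cases t) auto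
  then have "m mod t < t" "m div t < t" using assms by (auto simp: less_mult_imp_div_less)
  then show "0 < diagonal t m" "diagonal t m < 2 * t" unfolding diagonal_def by linarith+
qed

text \<open>Changing the walk at the position of cell \<open>m\<close> must not disturb the
  \<open>t\<close> preceding cells. Such a cell is in the same row, on another diagonal, or in the
  previous row and not left of \<open>m\<close>, hence on a strictly smaller diagonal.\<close>

lemma diagonal_neq:
  assumes "j < m" "m \<le> j + t" "0 < t"
  shows "diagonal t j \<noteq> diagonal t m"
proof -
  define a b where "a = m div t" "b = m mod t"
  then have m: "m = a * t + b" "b < t" using assms by auto
  show ?thesis
  proof (cases "a * t \<le> j")
    case True
    then obtain b' where "j = a * t + b'" by (metis le_iff_add)
    then show ?thesis using m assms by (auto simp: diagonal_eq)
  next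
    case False
    then obtain a' where a': "a = Suc a'" by (cases a) auto
    then have "a' * t \<le> j" using m assms by simp
    then obtain b' where "j = a' * t + b'" by (metis le_iff_add)
    moreover have "b' < t" "b \<le> b'" using calculation m assms False a' by auto
    moreover have "diagonal t j = a' + t - b'" "diagonal t m = Suc a' + t - b"
      using calculation m a' by (simp_all only: diagonal_eq)
    ultimately show ?thesis by simp
  qed
qed

text \<open>Vertically adjacent cells sit at consecutive walk positions, so the walk supplies the
  grid edge.\<close>

lemma diagonal_above:
  assumes "0 < t"
  shows "diagonal t (j + t) = Suc (diagonal t j)"
proof -
  have "(j + t) div t = Suc (j div t)" "(j + t) mod t = j mod t" using assms by simp_all
  then show ?thesis using mod_less_divisor[OF assms, of j] unfolding diagonal_def by linarith
qed

text \<open>The horizontal counterpart; the condition on \<open>Suc j\<close> excludes the first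
  cell of a row, whose predecessor ends the row before.\<close>

lemma diagonal_left:
  assumes "Suc j mod t \<noteq> 0" "0 < t"
  shows "diagonal t j = Suc (diagonal t (Suc j))"
  using assms mod_less_divisor[of t "Suc j"]
  by (auto simp: diagonal_def div_Suc mod_Suc split: if_splits)

text \<open>When cell \<open>m\<close> is placed, its upper and left neighbours, where they exist,
  are on the current walk just before and just after position \<open>diagonal t m\<close>.
  Exchanging the vertex there creates both edges at once.\<close>

lemma partial_grid:
  assumes T: "T \<subseteq> walks E U (2 * t)" "T \<noteq> {}"
    and robust: "\<forall>p\<in>T. \<forall>i<2 * t. t * t \<le> card {q \<in> T. omit i q = omit i p}"
    and "m \<le> t * t"
  shows "\<exists>p\<in>T. \<exists>f. inj_on f {..<m} \<and> f ` {..<m} \<subseteq> U \<and>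
    (\<forall>j. j + t < m \<longrightarrow> {f j, f (j + t)} \<in> E) \<and>
    (\<forall>j. Suc j < m \<and> Suc j mod t \<noteq> 0 \<longrightarrow> {f j, f (Suc j)} \<in> E) \<and>
    (\<forall>j<m. m \<le> j + t + 1 \<longrightarrow> p ! diagonal t j = f j)"
  using \<open>m \<le> t * t\<close>
proof (induction m)
  case 0
  then show ?case using T by auto
next
  case (Suc m)
  then have m: "m < t * t" by simp
  then have t: "0 < t" by (cases t) auto
  obtain p f where p: "p \<in> T" and inj: "inj_on f {..<m}" and fU: "f ` {..<m} \<subseteq> U"
    and vert: "\<forall>j. j + t < m \<longrightarrow> {f j, f (j + t)} \<in> E"
    and horiz: "\<forall>j. Suc j < m \<and> Suc j mod t \<noteq> 0 \<longrightarrow> {f j, f (Suc j)} \<in> E"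
    and cur: "\<forall>j<m. m \<le> j + t + 1 \<longrightarrow> p ! diagonal t j = f j"
    using Suc by auto
  let ?d = "diagonal t m"
  have len: "length q = 2 * t" if "q \<in> T" for q using that T by (auto simp: walks_def)
  have d: "?d < 2 * t" using diagonal_bounds m by blast
  have "card (f ` {..<m}) \<le> m" using card_image_le[of "{..<m}" f] by simp
  also have "m < card {q \<in> T. omit ?d q = omit ?d p}" using robust p d m by fastforce
  \<comment> \<open>All earlier images are avoided, including those no longer on the walk; this
    keeps \<open>f\<close> injective.\<close>
  finally obtain v where v: "v \<notin> f ` {..<m}" "p[?d := v] \<in> T"
    using exchange_vertex[of ?d p "f ` {..<m}" T] len p d by auto
  define p' where "p' = p[?d := v]"
  define f' where "f' = f(m := v)"
  have p': "p' \<in> walks E U (2 * t)" using v T p'_def by auto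
  have step: "{p' ! i, p' ! Suc i} \<in> E" if "Suc i < 2 * t" for i
    using p' that by (auto simp: walks_def successively_conv_nth)
  have p'd: "p' ! ?d = v" using d len[OF p] by (simp add: p'_def)
  \<comment> \<open>Cell \<open>m - t - 1\<close>, diagonally up and left of \<open>m\<close> unless
    \<open>m\<close> starts a row, shares its position and is overwritten. The other
    \<open>t\<close> cells remain, and \<open>m\<close> makes \<open>t + 1\<close> again.\<close>
  have p'other: "p' ! diagonal t j = f j" if "j < m" "m \<le> j + t" for j
    using that cur diagonal_neq[of j m t] t by (simp add: p'_def)
  have "v \<in> U" using p' p'd d by (metis (mono_tags, lifting) mem_Collect_eq nth_mem subsetD walks_def)
  then have f'U: "f' ` {..<Suc m} \<subseteq> U" using fU by (auto simp: f'_def lessThan_Suc)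
  have inj': "inj_on f' {..<Suc m}"
    using inj v by (auto simp: f'_def inj_on_def less_Suc_eq)
  have vert': "{f' j, f' (j + t)} \<in> E" if "j + t < Suc m" for j
  proof (cases "j + t = m")
    case True
    then have "{p' ! diagonal t j, p' ! ?d} \<in> E"
      using step[of "diagonal t j"] d diagonal_above[OF t, of j] by simp
    then show ?thesis using True t p'd p'other[of j] by (simp add: f'_def)
  next
    case False
    then show ?thesis using that vert t by (auto simp: f'_def)
  qed
  have horiz': "{f' j, f' (Suc j)} \<in> E" if "Suc j < Suc m" "Suc j mod t \<noteq> 0" for j
  proof (cases "Suc j = m")
    case True
    then have "diagonal t j = Suc ?d" using diagonal_left[of j t] that t by simp
    moreover have "diagonal t j < 2 * t" using diagonal_bounds[of j t] True m by simp
    ultimately have "{p' ! ?d, p' ! diagonal t j} \<in> E" using step[of ?d] by simp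
    then show ?thesis using True t p'd p'other[of j] by (simp add: f'_def insert_commute)
  next
    case False
    then show ?thesis using that horiz by (auto simp: f'_def)
  qed
  have "\<forall>j<Suc m. Suc m \<le> j + t + 1 \<longrightarrow> p' ! diagonal t j = f' j"
    using p'd p'other by (auto simp: f'_def less_Suc_eq)
  with v(2) inj' f'U vert' horiz' show ?case unfolding p'_def by blast
qed

text \<open>Passing to coordinates from 0 avoids truncated subtraction in the cell numbers.\<close>

lemma grid_vertices_cases:
  assumes "x \<in> grid_vertices t"
  obtains a b where "x = (Suc a, Suc b)" "a < t" "b < t"
  using assms that[of "fst x - 1" "snd x - 1"] by (cases x) (auto simp: grid_vertices_def)

lemma contains_grid:
  assumes "T \<subseteq> walks E U (2 * t)" "T \<noteq> {}" "U \<subseteq> V"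
    and "\<forall>p\<in>T. \<forall>i<2 * t. t * t \<le> card {q \<in> T. omit i q = omit i p}"
  shows "contains_copy V E (grid_vertices t) (grid_edges t)"
proof -
  obtain f where inj: "inj_on f {..<t * t}" and fU: "f ` {..<t * t} \<subseteq> U"
    and vert: "\<And>j. j + t < t * t \<Longrightarrow> {f j, f (j + t)} \<in> E"
    and horiz: "\<And>j. Suc j < t * t \<Longrightarrow> Suc j mod t \<noteq> 0 \<Longrightarrow> {f j, f (Suc j)} \<in> E"
    using partial_grid[OF assms(1,2,4) order_refl] by blast
  define num where "num = (\<lambda>(a, b). (a - 1) * t + (b - 1))"
  have num_less: "num x < t * t" if xg: "x \<in> grid_vertices t" for x
  proof -
    obtain a b where x: "x = (Suc a, Suc b)" "a < t" "b < t"
      using xg by (rule grid_vertices_cases)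
    have "a * t + b < Suc a * t" using x by simp
    also have "\<dots> \<le> t * t" using x by (intro mult_le_mono1) simp
    finally show ?thesis using x by (simp add: num_def)
  qed
  have "inj_on num (grid_vertices t)"
  proof (rule inj_onI)
    fix x y assume xy: "x \<in> grid_vertices t" "y \<in> grid_vertices t" "num x = num y"
    obtain a b where x: "x = (Suc a, Suc b)" "b < t"
      using xy(1) by (rule grid_vertices_cases)
    obtain a' b' where y: "y = (Suc a', Suc b')" "b' < t"
      using xy(2) by (rule grid_vertices_cases)
    have eq: "a * t + b = a' * t + b'" using xy(3) x y by (simp add: num_def)
    have "b = b'" using arg_cong[OF eq, of "\<lambda>m. m mod t"] x y by simp
    moreover have "a = a'" using arg_cong[OF eq, of "\<lambda>m. m div t"] x y by simp
    ultimately show "x = y" using x y by simp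
  qed
  then have "inj_on (f \<circ> num) (grid_vertices t)"
    using inj num_less by (intro comp_inj_on) (auto intro: inj_on_subset)
  moreover have "(f \<circ> num) ` grid_vertices t \<subseteq> V"
    using fU num_less assms(3) by fastforce
  moreover have "(f \<circ> num) ` e \<in> E" if eg: "e \<in> grid_edges t" for e
  proof -
    obtain x y where e: "e = {x, y}" and xy: "x \<in> grid_vertices t" "y \<in> grid_vertices t"
      "(fst x = fst y \<and> snd y = snd x + 1) \<or> (snd x = snd y \<and> fst y = fst x + 1)"
      using eg unfolding grid_edges_def by blast
    obtain a b where x: "x = (Suc a, Suc b)" "b < t"
      using xy(1) by (rule grid_vertices_cases)
    have "{f (num x), f (num y)} \<in> E"
      using xy(3)
    proof
      assume "fst x = fst y \<and> snd y = snd x + 1"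
      then have y: "y = (Suc a, Suc (Suc b))" using x by (cases y) auto
      \<comment> \<open>The nonzero remainder shows that \<open>y\<close> does not start a
        row.\<close>
      then have "num y = Suc (num x)" "num y mod t = Suc b"
        using x xy(2) by (auto simp: num_def grid_vertices_def)
      then show ?thesis using horiz[of "num x"] num_less[OF xy(2)] by simp
    next
      assume "snd x = snd y \<and> fst y = fst x + 1"
      then have y: "y = (Suc (Suc a), Suc b)" using x by (cases y) auto
      then have "num y = num x + t" using x by (auto simp: num_def)
      then show ?thesis using vert[of "num x"] num_less[OF xy(2)] by simp
    qed
    then show ?thesis using e by simp
  qed
  ultimately show ?thesis unfolding contains_copy_def by blast
qed

section \<open>Choice of constants and the extremal bound\<close>

text \<open>With \<open>s = t^2\<close>, \<open>k = 2 * t - 2\<close> and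
  \<open>c^2 = 25 * t^3 * n\<close>, the inner positions cost at most \<open>2/25\<close> of
  \<open>c^2\<close> and the two ends at most \<open>2/5\<close>, together
  \<open>12/25\<close>.\<close>

lemma dense_contains_grid:
  assumes "1 \<le> t" "t \<le> n" "finite V" "card V = n" "simple_graph V E"
    and edges: "5 * real t powr (3/2) * real n powr (3/2) < card E"
  shows "contains_copy V E (grid_vertices t) (grid_edges t)"
proof -
  define c where "c = 5 * real t powr (3/2) * real n powr (1/2)"
  have tn: "0 < t" "0 < n" using assms by auto
  have c_pos: "0 < c" using tn by (simp add: c_def)
  have "real n powr (3/2) = real n powr (1/2) * real n powr 1"
    by (subst powr_add[symmetric]) simp
  then have "c * card V < card E" using edges assms(4) tn by (simp add: c_def mult.assoc)
  then obtain U where U: "U \<subseteq> V" "U \<noteq> {}" "\<forall>v\<in>U. c \<le> card (nbhd E U v)"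
    using min_degree_subgraph[OF assms(3,5)] c_pos by (metis less_imp_le)
  have finU: "finite U" using U assms(3) finite_subset by blast
  interpret min_degree E U c
    using U finU c_pos by unfold_locales auto
  have "c\<^sup>2 = 25 * (real t powr (3/2))\<^sup>2 * (real n powr (1/2))\<^sup>2"
    by (simp add: c_def power_mult_distrib)
  also have "(real t powr (3/2))\<^sup>2 = real t ^ 3"
    using tn by (simp add: power2_eq_square flip: powr_add)
  also have "(real n powr (1/2))\<^sup>2 = n"
    using tn by (simp add: power2_eq_square flip: powr_add)
  finally have c2: "c\<^sup>2 = 25 * real t ^ 3 * n" .
  \<comment> \<open>Here \<open>t \<le> n\<close> enters: it gives \<open>t^2 \<le> c / 5\<close>,
    which controls the two ends of the walk.\<close>
  have "(5 * (real t)\<^sup>2)\<^sup>2 = 25 * real t ^ 3 * t"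
    by (simp add: power2_eq_square power3_eq_cube)
  also have "\<dots> \<le> c\<^sup>2" unfolding c2 using assms(2) by (intro mult_left_mono) auto
  finally have ct: "5 * (real t)\<^sup>2 \<le> c" by (rule power2_le_imp_le) (use c_pos in simp)
  have "real (card U) \<le> n" using card_mono[OF assms(3) U(1)] assms(4) by simp
  then have "real (t * t) * (real (2 * t - 2) * card U) \<le> real (t * t) * (real (2 * t) * n)"
    by (intro mult_left_mono mult_mono) auto
  also have "\<dots> = 2 / 25 * c\<^sup>2" by (simp add: c2 power3_eq_cube)
  finally have 1: "real (t * t) * (real (2 * t - 2) * card U) \<le> 2 / 25 * c\<^sup>2" .
  have "real (t * t) * (2 * c) \<le> c / 5 * (2 * c)"
    using ct c_pos by (intro mult_right_mono) (auto simp: power2_eq_square)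
  then have "real (t * t) * (2 * c) \<le> 2 / 5 * c\<^sup>2" by (simp add: power2_eq_square)
  moreover have "0 < c\<^sup>2" using c_pos by simp
  ultimately have less: "real (t * t) * (2 * c + real (2 * t - 2) * card U) < c\<^sup>2"
    unfolding distrib_left using 1 by linarith
  have eq: "Suc (Suc (2 * t - 2)) = 2 * t" using tn by simp
  obtain T where "T \<subseteq> walks E U (2 * t)" "T \<noteq> {}"
      "\<forall>p\<in>T. \<forall>i<2 * t. t * t \<le> card {q \<in> T. omit i q = omit i p}"
    using robust_walks[OF U(2) less, unfolded eq] by blast
  then show ?thesis using U(1) by (intro contains_grid)
qed

theorem theorem1p3:
  fixes t :: nat
  assumes "t \<ge> 1"
  shows "\<exists>N. \<forall>n\<ge>N. real (ex n (grid_vertices t) (grid_edges t))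
            \<le> 5 * real t powr (3/2) * real n powr (3/2)"
proof (intro exI allI impI)
  \<comment> \<open>The threshold is \<open>N = t\<close>.\<close>
  fix n assume n: "t \<le> n"
  define b where "b = 5 * real t powr (3/2) * real n powr (3/2)"
  define X where "X = {card E | E. simple_graph {0..<n} E \<and>
    \<not> contains_copy {0..<n} E (grid_vertices t) (grid_edges t)}"
  have "0 \<le> b" by (simp add: b_def)
  have "x \<le> nat \<lfloor>b\<rfloor>" if "x \<in> X" for x
  proof (rule le_nat_floor)
    show "real x \<le> b"
      using that dense_contains_grid[OF assms n, of "{0..<n}"] by (force simp: X_def b_def)
  qed
  \<comment> \<open>The empty case occurs for \<open>t = 1\<close>, where every graph with a vertex
    contains the grid; then \<open>Sup X\<close> is 0.\<close>
  then have "Sup X \<le> nat \<lfloor>b\<rfloor>"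
    by (cases "X = {}") (auto simp: cSup_least)
  then have "real (Sup X) \<le> b" using \<open>0 \<le> b\<close> by linarith
  then show "real (ex n (grid_vertices t) (grid_edges t)) \<le> 5 * real t powr (3/2) * real n powr (3/2)"
    by (simp add: ex_def X_def b_def)
qed

end
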